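(* Let $r\ge2$, let $G$ be a group with center $Z(G)$, let $\omega\colon G^r\to G$ be one of the operations listed below, and let $T$ be an arbitrary full ordered $r$-ary tree with leaves $1,\ldots,n$. Consider the property (P) there exists a bijection $F_T\colon G\to G$ such that $\omega_T(x_1,\ldots,x_n)=F_T(x_1\cdots x_n)$ for all $x_1,\ldots,x_n\in G$. (i) If $\omega(x_1,\ldots,x_r)=c\,x_1\cdots x_r$ with $c\in Z(G)$, then (P) holds for every full ordered $r$-ary tree $T$. (ii) If $\omega(x_1,\ldots,x_r)=a\,x_1\cdots x_r$ with $a\notin Z(G)$, let $k$ be the order of $aZ(G)$ in $G/Z(G)$. If $k<\infty$, then (P) holds if and only if $k$ divides every $\rho_T(i)$; if $k=\infty$, then (P) holds if and only if every $\rho_T(i)$ is $0$. (iii) If $\omega(x_1,\ldots,x_r)=x_1\cdots x_r\,b$ with $b\notin Z(G)$, let $k$ be the order of $bZ(G)$ in $G/Z(G)$. If $k<\infty$, then (P) holds if and only if $k$ divides every $\lambda_T(i)$; if $k=\infty$, then (P) holds if and only if every $\lambda_T(i)$ is $0$. (iv) If $\omega(x_1,\ldots,x_r)=d\,\psi(x_1\cdots x_r)$ with $d\in Z(G)$, $\psi\in\mathrm{Aut}(G)$ and $\psi\ne\mathrm{id}$, let $h$ be the order of $\psi$ in $\mathrm{Aut}(G)$. If $h<\infty$, then (P) holds if and only if all leaf depths of $T$ are congruent modulo $h$; if $h=\infty$, then (P) holds if and only if all leaf depths of $T$ are equal.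
   Context: A full ordered $r$-ary tree is either a single leaf or a root with an ordered $r$-tuple of full ordered $r$-ary subtrees. Leaves are numbered from left to right. For $\omega\colon G^r\to G$, $\omega_T\colon G^n\to G$ is obtained by placing $x_1,\ldots,x_n$ at the leaves in order and applying $\omega$ at each internal vertex to the values of its children in order (for the one-leaf tree $\omega_T(x)=x$). For a leaf $i$ of $T$, follow the path from the root to $i$. At each internal vertex on the path, the path enters one child; the subtrees rooted at the other children are left or right sibling subtrees. $\rho_T(i)$ is the total number of internal vertices in all right sibling subtrees encountered along the path, and $\lambda_T(i)$ is the total number of internal vertices in all left sibling subtrees encountered. The depth of a leaf is its distance from the root (the root has depth $0$). *)

theory Defs
  imports "HOL-Algebra.Algebra" "HOL-Number_Theory.Cong"
begin

datatype otree = Leaf | Node "otree list"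

fun full_tree :: "nat \<Rightarrow> otree \<Rightarrow> bool" where
  "full_tree r Leaf \<longleftrightarrow> True"
| "full_tree r (Node ts) \<longleftrightarrow> length ts = r \<and> (\<forall>t\<in>set ts. full_tree r t)"

primrec num_leaves :: "otree \<Rightarrow> nat" where
  "num_leaves Leaf = 1"
| "num_leaves (Node ts) = sum_list (map num_leaves ts)"

primrec num_internal :: "otree \<Rightarrow> nat" where
  "num_internal Leaf = 0"
| "num_internal (Node ts) = Suc (sum_list (map num_internal ts))"

text \<open>A leaf is identified with the path leading to it from the root, given as the list of
  (0-based) positions of the children entered.  All leaves are listed from left to right.\<close>

primrec leaf_paths :: "otree \<Rightarrow> nat list list" where
  "leaf_paths Leaf = [[]]"
| "leaf_paths (Node ts) =
     concat (map (\<lambda>(j, ps). map ((#) j) ps) (List.enumerate 0 (map leaf_paths ts)))"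

lemma length_leaf_paths: "length (leaf_paths t) = num_leaves t"
proof (induction t)
  case Leaf
  show ?case by simp
next
  case (Node ts)
  have "length (concat (map (\<lambda>(j, ps). map ((#) j) ps) (List.enumerate k (map leaf_paths ts))))
        = sum_list (map num_leaves ts)" for k
    using Node by (induction ts arbitrary: k) auto
  then show ?case by simp
qed

text \<open>Number of internal vertices in the right (resp. left) sibling subtrees met along a path
  from the root; only paths occurring in the tree matter.\<close>

fun right_internal :: "otree \<Rightarrow> nat list \<Rightarrow> nat" where
  "right_internal (Node ts) (j # p) =
     sum_list (map num_internal (drop (Suc j) ts)) + right_internal (ts ! j) p"
| "right_internal _ _ = 0"

fun left_internal :: "otree \<Rightarrow> nat list \<Rightarrow> nat" where
  "left_internal (Node ts) (j # p) =
     sum_list (map num_internal (take j ts)) + left_internal (ts ! j) p"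
| "left_internal _ _ = 0"

text \<open>Leaves are numbered \<open>1, \<dots>, num_leaves t\<close>.\<close>

definition leaf :: "otree \<Rightarrow> nat \<Rightarrow> nat list" where
  "leaf t i = leaf_paths t ! (i - 1)"

definition rho :: "otree \<Rightarrow> nat \<Rightarrow> nat" where
  "rho t i = right_internal t (leaf t i)"

definition lam :: "otree \<Rightarrow> nat \<Rightarrow> nat" where
  "lam t i = left_internal t (leaf t i)"

definition leaf_depth :: "otree \<Rightarrow> nat \<Rightarrow> nat" where
  "leaf_depth t i = length (leaf t i)"

definition tuples :: "nat \<Rightarrow> 'a set \<Rightarrow> 'a list set" where
  "tuples n A = {xs. length xs = n \<and> set xs \<subseteq> A}"

text \<open>An operation \<open>\<omega> : G\<^sup>r \<rightarrow> G\<close> is a function on lists, of which only the values on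
  \<open>tuples r (carrier G)\<close> are relevant.  The list of inputs of \<open>tree_op\<close> is cut into consecutive
  blocks, one for each child, of the sizes given by the numbers of leaves.\<close>

fun tree_op :: "('a list \<Rightarrow> 'a) \<Rightarrow> otree \<Rightarrow> 'a list \<Rightarrow> 'a"
  and forest_op :: "('a list \<Rightarrow> 'a) \<Rightarrow> otree list \<Rightarrow> 'a list \<Rightarrow> 'a list" where
  "tree_op \<omega> Leaf xs = hd xs"
| "tree_op \<omega> (Node ts) xs = \<omega> (forest_op \<omega> ts xs)"
| "forest_op \<omega> [] xs = []"
| "forest_op \<omega> (t # ts) xs =
     tree_op \<omega> t (take (num_leaves t) xs) # forest_op \<omega> ts (drop (num_leaves t) xs)"

definition list_prod :: "('a, 'b) monoid_scheme \<Rightarrow> 'a list \<Rightarrow> 'a" where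
  "list_prod G xs = foldr (\<otimes>\<^bsub>G\<^esub>) xs \<one>\<^bsub>G\<^esub>"

definition group_center :: "('a, 'b) monoid_scheme \<Rightarrow> 'a set" where
  "group_center G = {z \<in> carrier G. \<forall>g\<in>carrier G. z \<otimes>\<^bsub>G\<^esub> g = g \<otimes>\<^bsub>G\<^esub> z}"

lemma (in group) group_center_normal: "group_center G \<lhd> G"
proof -
  have Z: "z \<in> group_center G \<longleftrightarrow> z \<in> carrier G \<and> (\<forall>g\<in>carrier G. z \<otimes> g = g \<otimes> z)" for z
    by (simp add: group_center_def)
  have "subgroup (group_center G) G"
  proof (rule subgroupI)
    show "group_center G \<subseteq> carrier G" by (auto simp: Z)
    have "\<one> \<in> group_center G" by (simp add: Z)
    then show "group_center G \<noteq> {}" by blast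
  next
    fix a assume "a \<in> group_center G"
    then have a: "a \<in> carrier G" and c: "\<And>g. g \<in> carrier G \<Longrightarrow> a \<otimes> g = g \<otimes> a"
      by (auto simp: Z)
    have "inv a \<otimes> g = g \<otimes> inv a" if g: "g \<in> carrier G" for g
    proof -
      have "inv (a \<otimes> inv g) = inv (inv g \<otimes> a)" using c[of "inv g"] g by simp
      then show ?thesis using a g by (simp add: inv_mult_group)
    qed
    then show "inv a \<in> group_center G" using a by (simp add: Z)
  next
    fix a b assume "a \<in> group_center G" "b \<in> group_center G"
    then have ab: "a \<in> carrier G" "b \<in> carrier G"
      and c: "\<And>g. g \<in> carrier G \<Longrightarrow> a \<otimes> g = g \<otimes> a" "\<And>g. g \<in> carrier G \<Longrightarrow> b \<otimes> g = g \<otimes> b"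
      by (auto simp: Z)
    have "a \<otimes> b \<otimes> g = g \<otimes> (a \<otimes> b)" if g: "g \<in> carrier G" for g
    proof -
      have "a \<otimes> b \<otimes> g = a \<otimes> (g \<otimes> b)" using ab g c(2)[OF g] by (simp add: m_assoc)
      also have "\<dots> = a \<otimes> g \<otimes> b" using ab g by (simp add: m_assoc)
      also have "\<dots> = g \<otimes> (a \<otimes> b)" using ab g c(1)[OF g] by (simp add: m_assoc)
      finally show ?thesis .
    qed
    then show "a \<otimes> b \<in> group_center G" using ab by (simp add: Z)
  qed
  moreover have "x \<otimes> h \<otimes> inv x \<in> group_center G"
    if x: "x \<in> carrier G" and h: "h \<in> group_center G" for x h
  proof -
    have "h \<in> carrier G" "x \<otimes> h = h \<otimes> x" using x h by (simp_all add: Z)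
    then have "x \<otimes> h \<otimes> inv x = h" using x by (simp add: m_assoc)
    then show ?thesis using h by simp
  qed
  ultimately show ?thesis by (simp add: normal_inv_iff)
qed

text \<open>The order of the class of \<open>a\<close> in the quotient by the center.  Elements of infinite order
  have \<open>ord\<close> equal to \<open>0\<close>.\<close>

definition ord_mod_center :: "('a, 'b) monoid_scheme \<Rightarrow> 'a \<Rightarrow> nat" where
  "ord_mod_center G a = group.ord (G Mod group_center G) (group_center G #>\<^bsub>G\<^esub> a)"

definition factors_through_product ::
    "('a, 'b) monoid_scheme \<Rightarrow> ('a list \<Rightarrow> 'a) \<Rightarrow> otree \<Rightarrow> bool" where
  "factors_through_product G \<omega> T \<longleftrightarrow>
     (\<exists>F. bij_betw F (carrier G) (carrier G) \<and>
          (\<forall>xs\<in>tuples (num_leaves T) (carrier G). tree_op \<omega> T xs = F (list_prod G xs)))"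

end

theory Submission
  imports Defs
begin

text \<open>
  All four families are governed by one normal form.  For a suitable automorphism \<open>\<phi>\<close>, constants
  \<open>C\<close>, \<open>D\<close> and natural numbers \<open>w\<^sub>i\<close> attached to the leaves,
  \<open>\<omega>\<^sub>T(x\<^sub>1, \<dots>, x\<^sub>n) = C \<cdot> \<phi>\<^bsup>w\<^sub>1\<^esup>(x\<^sub>1) \<cdots> \<phi>\<^bsup>w\<^sub>n\<^esup>(x\<^sub>n) \<cdot> D\<close>.
  Such an expression depends on the product of the \<open>x\<^sub>i\<close> only if putting \<open>g\<close> at leaf \<open>i\<close> and
  \<open>\<one>\<close> elsewhere gives a result that does not depend on \<open>i\<close>, that is, if all \<open>\<phi>\<^bsup>w\<^sub>i\<^esup>\<close>
  coincide; conversely, if they do, it equals \<open>C \<cdot> \<phi>\<^bsup>w\<^esup>(x\<^sub>1 \<cdots> x\<^sub>n) \<cdot> D\<close>, and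
  \<open>y \<mapsto> C \<cdot> \<phi>\<^bsup>w\<^esup>(y) \<cdot> D\<close> is a bijection.  The powers coincide exactly when the
  exponents are congruent modulo the order of \<open>\<phi>\<close>.  This is \<open>twisted_factorization_criterion\<close>.

  If \<open>\<omega>\<close> multiplies by \<open>a\<close> on the left, every internal vertex contributes one letter \<open>a\<close>, and
  the letters standing to the right of \<open>x\<^sub>i\<close> in the resulting word come from the internal
  vertices in right sibling subtrees along the path to leaf \<open>i\<close>.  Moving every \<open>a\<close> to the front
  past \<open>x\<^sub>i\<close> conjugates \<open>x\<^sub>i\<close>, so \<open>\<phi>\<close> is conjugation by the inverse of \<open>a\<close>, the exponent is
  \<open>\<rho>\<^sub>T(i)\<close>, and the order of \<open>\<phi>\<close> is the order of \<open>a\<close> modulo the center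
  (\<open>tree_op_left_factor\<close>).  Multiplication by \<open>b\<close> on the right is the mirror image, with the
  letters moved to the end and exponents \<open>\<lambda>\<^sub>T(i)\<close> (\<open>tree_op_right_factor\<close>).  In both cases
  some leaf, the last or the first, has exponent \<open>0\<close>, so that congruence of all exponents means
  divisibility of all of them.  If \<open>\<omega>\<close> applies \<open>\<psi>\<close> to the product and multiplies by a central
  element, then \<open>\<phi> = \<psi>\<close>, the exponents are the depths of the leaves, and the central factors
  collect at the front without changing anything (\<open>tree_op_central_factor\<close>); \<open>\<psi> = id\<close> gives
  the first family.
\<close>

section \<open>Weights of leaves\<close>

abbreviation right_weights :: "otree \<Rightarrow> nat list" where
  "right_weights T \<equiv> map (right_internal T) (leaf_paths T)"

abbreviation left_weights :: "otree \<Rightarrow> nat list" where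
  "left_weights T \<equiv> map (left_internal T) (leaf_paths T)"

abbreviation depths :: "otree \<Rightarrow> nat list" where
  "depths T \<equiv> map length (leaf_paths T)"

text \<open>
  The recursion along the list of children lets a forest be treated as the tree obtained by
  joining its members under a new root.  Consing a child renumbers the positions of the others,
  hence the shift of the first entry of their paths.
\<close>

lemma leaf_paths_Node_Cons:
  "leaf_paths (Node (t # ts)) =
     map ((#) 0) (leaf_paths t) @ map (\<lambda>p. Suc (hd p) # tl p) (leaf_paths (Node ts))"
proof -
  have "concat (map (\<lambda>(j, ps). map ((#) j) ps) (List.enumerate (Suc k) pss))
      = map (\<lambda>p. Suc (hd p) # tl p) (concat (map (\<lambda>(j, ps). map ((#) j) ps) (List.enumerate k pss)))"
    for k and pss :: "nat list list list"
    by (induction pss arbitrary: k) (simp_all add: o_def)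
  from this[of 0] show ?thesis
    by simp
qed

lemma leaf_paths_Node_nonempty: "p \<in> set (leaf_paths (Node ts)) \<Longrightarrow> p \<noteq> []"
  by auto

text \<open>
  The three recursions below say how much the weights inside one child grow when siblings are
  added: for right weights the new leftmost child sees all the others, for left weights all the
  others see it, and for depths only the passage through the root counts.
\<close>

lemma right_weights_Node_Cons:
  "right_weights (Node (t # ts)) =
     map ((+) (sum_list (map num_internal ts))) (right_weights t) @ right_weights (Node ts)"
proof -
  have "right_internal (Node (t # ts)) (Suc (hd p) # tl p) = right_internal (Node ts) p"
    if "p \<in> set (leaf_paths (Node ts))" for p
    using leaf_paths_Node_nonempty[OF that] by (cases p) simp_all
  then show ?thesis
    unfolding leaf_paths_Node_Cons map_append map_map
    by (simp add: o_def del: leaf_paths.simps)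
qed

lemma left_weights_Node_Cons:
  "left_weights (Node (t # ts)) =
     left_weights t @ map ((+) (num_internal t)) (left_weights (Node ts))"
proof -
  have "left_internal (Node (t # ts)) (Suc (hd p) # tl p)
      = num_internal t + left_internal (Node ts) p"
    if "p \<in> set (leaf_paths (Node ts))" for p
    using leaf_paths_Node_nonempty[OF that] by (cases p) simp_all
  then show ?thesis
    unfolding leaf_paths_Node_Cons map_append map_map
    by (simp add: o_def del: leaf_paths.simps)
qed

lemma depths_Node_Cons: "depths (Node (t # ts)) = map Suc (depths t) @ depths (Node ts)"
proof -
  have "length (Suc (hd p) # tl p) = length p" if "p \<in> set (leaf_paths (Node ts))" for p
    using leaf_paths_Node_nonempty[OF that] by (cases p) simp_all
  then show ?thesis
    unfolding leaf_paths_Node_Cons map_append map_map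
    by (simp add: o_def del: leaf_paths.simps)
qed

lemma leaf_image: "leaf T ` {1..num_leaves T} = set (leaf_paths T)"
proof -
  have "leaf T ` {1..num_leaves T} = (\<lambda>i. leaf_paths T ! i) ` {..<length (leaf_paths T)}"
    by (force simp: leaf_def length_leaf_paths image_iff)
  then show ?thesis
    by (auto simp: set_conv_nth)
qed

lemma ball_leaves:
  "(\<forall>w\<in>set (map f (leaf_paths T)). P w) \<longleftrightarrow> (\<forall>i\<in>{1..num_leaves T}. P (f (leaf T i)))"
  unfolding set_map leaf_image[symmetric] by blast

lemma zero_right_weight:
  assumes "full_tree r T" "0 < r"
  shows "0 \<in> set (right_weights T)"
  using assms
proof (induction T)
  case Leaf
  then show ?case by simp
next
  case (Node ts)
  then have "ts \<noteq> []" "\<forall>t\<in>set ts. 0 \<in> set (right_weights t)"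
    by auto
  then show ?case
  proof (induction ts rule: list_nonempty_induct)
    case (single t)
    then show ?case unfolding right_weights_Node_Cons by simp
  next
    case (cons t ts)
    then show ?case unfolding right_weights_Node_Cons by simp
  qed
qed

lemma zero_left_weight:
  assumes "full_tree r T" "0 < r"
  shows "0 \<in> set (left_weights T)"
  using assms
proof (induction T)
  case Leaf
  then show ?case by simp
next
  case (Node ts)
  then obtain t us where "ts = t # us" "0 \<in> set (left_weights t)"
    by (cases ts) auto
  then show ?case
    by (simp only: left_weights_Node_Cons set_append Un_iff simp_thms)
qed

section \<open>Twisted products\<close>

definition twisted_prod ::
    "('a, 'b) monoid_scheme \<Rightarrow> ('a \<Rightarrow> 'a) \<Rightarrow> nat list \<Rightarrow> 'a list \<Rightarrow> 'a" where
  "twisted_prod G \<phi> ws xs = list_prod G (map2 (\<lambda>m. \<phi> ^^ m) ws xs)"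

lemma funpow_iso: "\<phi> \<in> iso G G \<Longrightarrow> (\<phi> ^^ m) \<in> iso G G"
proof (induction m)
  case 0
  show ?case by (simp add: iso_def hom_def bij_betw_def)
next
  case (Suc m)
  then show ?case using iso_set_trans[of "\<phi> ^^ m" G G \<phi> G] by (simp add: compose_def o_def)
qed

lemma iso_closed: "\<phi> \<in> iso G G \<Longrightarrow> x \<in> carrier G \<Longrightarrow> \<phi> x \<in> carrier G"
  by (auto simp: iso_def hom_def)

lemma iso_mult:
  "\<phi> \<in> iso G G \<Longrightarrow> x \<in> carrier G \<Longrightarrow> y \<in> carrier G \<Longrightarrow> \<phi> (x \<otimes>\<^bsub>G\<^esub> y) = \<phi> x \<otimes>\<^bsub>G\<^esub> \<phi> y"
  by (auto simp: iso_def hom_def)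

lemma length_forest_op: "length (forest_op \<omega> ts xs) = length ts"
  by (induction ts arbitrary: xs) simp_all

context group
begin

lemma inv_cancel_left [simp]:
  assumes "a \<in> carrier G" "x \<in> carrier G"
  shows "inv a \<otimes> (a \<otimes> x) = x" "a \<otimes> (inv a \<otimes> x) = x"
  using assms by (simp_all add: m_assoc[symmetric])

lemma list_prod_simps [simp]:
  "list_prod G [] = \<one>" "list_prod G (x # xs) = x \<otimes> list_prod G xs"
  by (simp_all add: list_prod_def)

lemma list_prod_closed: "set xs \<subseteq> carrier G \<Longrightarrow> list_prod G xs \<in> carrier G"
  by (induction xs) auto

lemma list_prod_append:
  "set xs \<subseteq> carrier G \<Longrightarrow> set ys \<subseteq> carrier G \<Longrightarrow>
     list_prod G (xs @ ys) = list_prod G xs \<otimes> list_prod G ys"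
  by (induction xs) (auto simp: m_assoc list_prod_closed)

lemma iso_one: "\<phi> \<in> iso G G \<Longrightarrow> \<phi> \<one> = \<one>"
  using hom_one[of \<phi> G G] by (simp add: iso_def group_axioms)

lemma iso_list_prod:
  "\<phi> \<in> iso G G \<Longrightarrow> set xs \<subseteq> carrier G \<Longrightarrow> \<phi> (list_prod G xs) = list_prod G (map \<phi> xs)"
  by (induction xs) (auto simp: iso_one iso_mult list_prod_closed)

lemma twisted_factors_closed:
  "\<phi> \<in> iso G G \<Longrightarrow> set xs \<subseteq> carrier G \<Longrightarrow> set (map2 (\<lambda>m. \<phi> ^^ m) ws xs) \<subseteq> carrier G"
  by (auto dest: set_zip_rightD iso_closed[OF funpow_iso])

lemma twisted_prod_closed:
  "\<phi> \<in> iso G G \<Longrightarrow> set xs \<subseteq> carrier G \<Longrightarrow> twisted_prod G \<phi> ws xs \<in> carrier G"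
  unfolding twisted_prod_def by (intro list_prod_closed twisted_factors_closed)

lemma twisted_prod_append:
  assumes "\<phi> \<in> iso G G" "set xs \<subseteq> carrier G"
  shows "twisted_prod G \<phi> (us @ ws) xs =
    twisted_prod G \<phi> us (take (length us) xs) \<otimes> twisted_prod G \<phi> ws (drop (length us) xs)"
  unfolding twisted_prod_def zip_append1 map_append
  by (intro list_prod_append twisted_factors_closed)
     (use assms in \<open>auto dest: in_set_takeD in_set_dropD\<close>)

text \<open>
  Raising all exponents by \<open>m\<close> is what the passage from a child to its parent amounts to; the
  extra power of \<open>\<phi>\<close> leaves the product because it is a homomorphism.
\<close>

lemma twisted_prod_shift:
  assumes "\<phi> \<in> iso G G" "set xs \<subseteq> carrier G"
  shows "twisted_prod G \<phi> (map ((+) m) ws) xs = (\<phi> ^^ m) (twisted_prod G \<phi> ws xs)"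
  unfolding twisted_prod_def
    iso_list_prod[OF funpow_iso[OF assms(1)] twisted_factors_closed[OF assms]]
  by (simp add: zip_map1 case_prod_unfold o_def funpow_add)

lemma twisted_prod_constant:
  assumes "\<phi> \<in> iso G G" "set xs \<subseteq> carrier G" "length ws = length xs"
    and "\<And>w x. w \<in> set ws \<Longrightarrow> x \<in> carrier G \<Longrightarrow> (\<phi> ^^ w) x = (\<phi> ^^ m) x"
  shows "twisted_prod G \<phi> ws xs = (\<phi> ^^ m) (list_prod G xs)"
proof -
  have "map2 (\<lambda>m. \<phi> ^^ m) ws xs = map (\<phi> ^^ m) xs"
    using assms(2-4) by (intro nth_equalityI) (auto simp: subset_iff)
  then show ?thesis
    by (simp add: twisted_prod_def iso_list_prod funpow_iso assms)
qed

lemma list_prod_single: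
  "i < n \<Longrightarrow> g \<in> carrier G \<Longrightarrow> list_prod G ((replicate n \<one>)[i := g]) = g"
proof (induction n arbitrary: i)
  case (Suc n)
  have "list_prod G (replicate n \<one>) = \<one>"
    by (induction n) simp_all
  with Suc show ?case by (cases i) simp_all
qed simp

lemma twisted_prod_single:
  assumes "\<phi> \<in> iso G G" "i < length ws" "g \<in> carrier G"
  shows "twisted_prod G \<phi> ws ((replicate (length ws) \<one>)[i := g]) = (\<phi> ^^ (ws ! i)) g"
proof -
  have "map2 (\<lambda>m. \<phi> ^^ m) ws ((replicate (length ws) \<one>)[i := g])
      = (replicate (length ws) \<one>)[i := (\<phi> ^^ (ws ! i)) g]"
    using iso_one[OF funpow_iso[OF assms(1)]] assms(2)
    by (intro nth_equalityI) (auto simp: nth_list_update)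
  then show ?thesis
    using assms by (simp add: twisted_prod_def list_prod_single iso_closed[OF funpow_iso])
qed

lemma two_sided_translate_bij:
  assumes "C \<in> carrier G" "D \<in> carrier G" "\<phi> \<in> iso G G"
  shows "bij_betw (\<lambda>x. C \<otimes> \<phi> x \<otimes> D) (carrier G) (carrier G)"
proof -
  have "bij_betw (\<lambda>y. C \<otimes> y \<otimes> D) (carrier G) (carrier G)"
    by (rule bij_betwI[where g = "\<lambda>z. inv C \<otimes> z \<otimes> inv D"])
       (use assms in \<open>auto simp: m_assoc\<close>)
  moreover have "bij_betw \<phi> (carrier G) (carrier G)"
    using assms by (simp add: iso_def)
  ultimately show ?thesis
    using bij_betw_trans by (fastforce simp: o_def)
qed

section \<open>The criterion\<close>

text \<open>
  Since \<open>\<phi>\<close> is injective, the smaller of two exponents can be cancelled.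
\<close>

lemma funpow_eq_iff_cong:
  assumes \<phi>: "\<phi> \<in> iso G G"
    and k: "\<And>m. (\<forall>x\<in>carrier G. (\<phi> ^^ m) x = x) \<longleftrightarrow> k dvd m"
  shows "(\<forall>x\<in>carrier G. (\<phi> ^^ m) x = (\<phi> ^^ n) x) \<longleftrightarrow> [m = n] (mod k)"
proof -
  have *: "(\<forall>x\<in>carrier G. (\<phi> ^^ (m + d)) x = (\<phi> ^^ m) x) \<longleftrightarrow> [m + d = m] (mod k)" for m d
  proof -
    have "inj_on (\<phi> ^^ m) (carrier G)"
      using funpow_iso[OF \<phi>, of m] by (auto simp: iso_def bij_betw_def)
    then have "(\<phi> ^^ (m + d)) x = (\<phi> ^^ m) x \<longleftrightarrow> (\<phi> ^^ d) x = x" if "x \<in> carrier G" for x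
      using that iso_closed[OF funpow_iso[OF \<phi>]] by (auto simp: funpow_add inj_on_eq_iff)
    then show ?thesis
      using k[of d] by (simp add: cong_add_lcancel_0_nat cong_0_iff)
  qed
  show ?thesis
  proof (cases "m \<le> n")
    case True
    then show ?thesis using *[of m "n - m"] by (auto simp: cong_sym_eq eq_commute)
  next
    case False
    then show ?thesis using *[of n "m - n"] by auto
  qed
qed

lemma pairwise_cong_iff_dvd:
  assumes "(0::nat) \<in> A"
  shows "(\<forall>u\<in>A. \<forall>w\<in>A. [u = w] (mod k)) \<longleftrightarrow> (\<forall>w\<in>A. k dvd w)"
proof
  assume "\<forall>u\<in>A. \<forall>w\<in>A. [u = w] (mod k)"
  then have "\<forall>u\<in>A. [u = 0] (mod k)"
    using assms by blast
  then show "\<forall>w\<in>A. k dvd w"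
    by (simp add: cong_0_iff)
qed (simp add: cong_def dvd_eq_mod_eq_0)

text \<open>
  Feeding \<open>g\<close> into one leaf and \<open>\<one>\<close> into all the others, the product of the inputs is always
  \<open>g\<close>, whereas the output shows the exponent at the chosen leaf; so if the output depends on the
  product only, cancelling \<open>C\<close> and \<open>D\<close> forces all exponents to act alike.  If they do, the
  common power of \<open>\<phi>\<close> can be pulled out of the product, being multiplicative.  The parameter
  \<open>k\<close> is the order of \<open>\<phi>\<close>, with \<open>k = 0\<close> for infinite order; as congruence modulo \<open>0\<close> is
  equality, finite and infinite order need no separate treatment.
\<close>

lemma twisted_factorization_criterion:
  assumes \<phi>: "\<phi> \<in> iso G G"
    and k: "\<And>m. (\<forall>x\<in>carrier G. (\<phi> ^^ m) x = x) \<longleftrightarrow> k dvd m"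
    and CD: "C \<in> carrier G" "D \<in> carrier G"
    and len: "length ws = num_leaves T"
    and op: "\<And>xs. xs \<in> tuples (num_leaves T) (carrier G) \<Longrightarrow>
      tree_op \<omega> T xs = C \<otimes> twisted_prod G \<phi> ws xs \<otimes> D"
  shows "factors_through_product G \<omega> T \<longleftrightarrow> (\<forall>u\<in>set ws. \<forall>w\<in>set ws. [u = w] (mod k))"
proof
  assume "factors_through_product G \<omega> T"
  then obtain F where
    F: "\<And>xs. xs \<in> tuples (num_leaves T) (carrier G) \<Longrightarrow> tree_op \<omega> T xs = F (list_prod G xs)"
    unfolding factors_through_product_def by auto
  have *: "C \<otimes> (\<phi> ^^ w) g \<otimes> D = F g" if w: "w \<in> set ws" and g: "g \<in> carrier G" for w g
  proof -
    obtain i where i: "i < length ws" "w = ws ! i"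
      using w by (auto simp: in_set_conv_nth)
    have "set ((replicate (length ws) \<one>)[i := g]) \<subseteq> insert g (set (replicate (length ws) \<one>))"
      by (rule set_update_subset_insert)
    then have "(replicate (length ws) \<one>)[i := g] \<in> tuples (num_leaves T) (carrier G)"
      using g len by (auto simp: tuples_def)
    from op[OF this] F[OF this] show ?thesis
      using i g \<phi> by (simp add: twisted_prod_single list_prod_single)
  qed
  have "(\<phi> ^^ u) g = (\<phi> ^^ w) g" if "u \<in> set ws" "w \<in> set ws" "g \<in> carrier G" for u w g
    using *[OF that(1,3)] *[OF that(2,3)] CD that(3) iso_closed[OF funpow_iso[OF \<phi>]]
    by (metis l_cancel r_cancel m_closed)
  then show "\<forall>u\<in>set ws. \<forall>w\<in>set ws. [u = w] (mod k)"
    using funpow_eq_iff_cong[OF \<phi> k] by blast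
next
  assume cong: "\<forall>u\<in>set ws. \<forall>w\<in>set ws. [u = w] (mod k)"
  obtain m where m: "\<And>w. w \<in> set ws \<Longrightarrow> [w = m] (mod k)"
  proof (cases ws)
    case Nil
    then show ?thesis using that by simp
  next
    case (Cons m _)
    then show ?thesis using that[of m] cong by simp
  qed
  let ?F = "\<lambda>x. C \<otimes> (\<phi> ^^ m) x \<otimes> D"
  have "tree_op \<omega> T xs = ?F (list_prod G xs)" if xs: "xs \<in> tuples (num_leaves T) (carrier G)" for xs
  proof -
    have "twisted_prod G \<phi> ws xs = (\<phi> ^^ m) (list_prod G xs)"
      using xs len m funpow_eq_iff_cong[OF \<phi> k]
      by (intro twisted_prod_constant[OF \<phi>]) (auto simp: tuples_def)
    with op[OF xs] show ?thesis by simp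
  qed
  then show "factors_through_product G \<omega> T"
    unfolding factors_through_product_def
    using two_sided_translate_bij[OF CD funpow_iso[OF \<phi>]] by blast
qed

section \<open>Orders modulo the center and conjugation\<close>

lemma group_centerD:
  "z \<in> group_center G \<Longrightarrow> z \<in> carrier G"
  "z \<in> group_center G \<Longrightarrow> g \<in> carrier G \<Longrightarrow> z \<otimes> g = g \<otimes> z"
  by (auto simp: group_center_def)

lemma pow_in_center_iff:
  assumes a: "a \<in> carrier G"
  shows "a [^] m \<in> group_center G \<longleftrightarrow> ord_mod_center G a dvd (m::nat)"
proof -
  interpret Z: normal "group_center G" G by (rule group_center_normal)
  interpret Q: group "G Mod group_center G" by (rule Z.factorgroup_is_group)
  interpret h: group_hom G "G Mod group_center G" "\<lambda>x. group_center G #> x"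
    by unfold_locales (rule Z.r_coset_hom_Mod)
  have "a [^] m \<in> group_center G \<longleftrightarrow> group_center G #> (a [^] m) = \<one>\<^bsub>G Mod group_center G\<^esub>"
    using a coset_join1 coset_join2 Z.subgroup_axioms Z.subset by (metis nat_pow_closed one_FactGroup)
  also have "\<dots> \<longleftrightarrow> ord_mod_center G a dvd m"
    using a by (simp add: h.hom_nat_pow Q.pow_eq_id ord_mod_center_def del: one_FactGroup)
  finally show ?thesis .
qed

definition conj_by :: "'a \<Rightarrow> 'a \<Rightarrow> 'a" where
  "conj_by b x = b \<otimes> x \<otimes> inv b"

lemma conj_by_iso:
  assumes b: "b \<in> carrier G"
  shows "conj_by b \<in> iso G G"
proof -
  have "bij_betw (\<lambda>x. b \<otimes> x \<otimes> inv b) (carrier G) (carrier G)"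
    using two_sided_translate_bij[of b "inv b" id] b by (simp add: iso_set_refl id_def)
  moreover have "b \<otimes> (x \<otimes> y) \<otimes> inv b = b \<otimes> x \<otimes> inv b \<otimes> (b \<otimes> y \<otimes> inv b)"
    if "x \<in> carrier G" "y \<in> carrier G" for x y
  proof -
    have "inv b \<otimes> (b \<otimes> (y \<otimes> inv b)) = y \<otimes> inv b"
      using that b by (simp add: m_assoc[symmetric])
    then show ?thesis
      using that b by (simp add: m_assoc)
  qed
  ultimately show ?thesis
    using b by (auto simp: iso_def hom_def conj_by_def[abs_def])
qed

lemma funpow_conj_by:
  assumes "b \<in> carrier G" "x \<in> carrier G"
  shows "(conj_by b ^^ m) x = conj_by (b [^] m) x"
proof (induction m)
  case 0
  then show ?case using assms by (simp add: conj_by_def)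
next
  case (Suc m)
  have "b [^] Suc m = b \<otimes> b [^] m"
    using assms nat_pow_Suc2 by blast
  then show ?case
    using Suc assms by (simp add: conj_by_def inv_mult_group m_assoc del: nat_pow_Suc)
qed

lemma conj_by_commute:
  "b \<in> carrier G \<Longrightarrow> x \<in> carrier G \<Longrightarrow> conj_by b x \<otimes> b = b \<otimes> x"
  by (simp add: conj_by_def m_assoc)

text \<open>
  The order of an inner automorphism is the order of its element modulo the center, because a
  power of \<open>b\<close> acts trivially by conjugation precisely when it is central.
\<close>

lemma funpow_conj_by_eq_id_iff:
  assumes b: "b \<in> carrier G"
  shows "(\<forall>x\<in>carrier G. (conj_by b ^^ m) x = x) \<longleftrightarrow> ord_mod_center G b dvd m"
proof -
  have "conj_by (b [^] m) x = x \<longleftrightarrow> b [^] m \<otimes> x = x \<otimes> b [^] m" if "x \<in> carrier G" for x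
    using b that by (metis conj_by_commute conj_by_def inv_solve_right m_closed nat_pow_closed)
  then show ?thesis
    using b pow_in_center_iff[OF b, of m] by (simp add: funpow_conj_by group_center_def)
qed

lemma ord_mod_center_inv:
  assumes a: "a \<in> carrier G"
  shows "ord_mod_center G (inv a) = ord_mod_center G a"
proof -
  interpret Z: normal "group_center G" G by (rule group_center_normal)
  have "inv a [^] m \<in> group_center G \<longleftrightarrow> a [^] m \<in> group_center G" for m :: nat
    using a Z.m_inv_closed by (metis inv_inv nat_pow_closed nat_pow_inv)
  then have "ord_mod_center G (inv a) dvd m \<longleftrightarrow> ord_mod_center G a dvd m" for m
    using a by (simp add: pow_in_center_iff)
  then show ?thesis
    by (meson dvd_antisym dvd_refl)
qed

section \<open>Evaluation of tree operations\<close>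

text \<open>
  The exchange rules: a power of the letter passes an element at the price of as many
  conjugations.  The first rule moves letters to the right, the second one to the left.
\<close>

lemma funpow_conj_by_commute:
  "b \<in> carrier G \<Longrightarrow> x \<in> carrier G \<Longrightarrow> (conj_by b ^^ m) x \<otimes> b [^] m = b [^] m \<otimes> x"
  by (simp add: funpow_conj_by conj_by_commute)

lemma funpow_conj_by_inv_commute:
  "a \<in> carrier G \<Longrightarrow> x \<in> carrier G \<Longrightarrow>
     a [^] m \<otimes> (conj_by (inv a) ^^ m) x = x \<otimes> a [^] m"
  by (simp add: funpow_conj_by conj_by_def nat_pow_inv m_assoc)

text \<open>
  When the values of the children are multiplied, the letters \<open>a\<close> of the later children have to
  pass the value of the first child.  Each of them raises its exponents by one, which is exactly
  the growth of the right weights.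
\<close>

lemma forest_op_left_factor:
  assumes a: "a \<in> carrier G"
    and trees: "\<And>t xs. t \<in> set ts \<Longrightarrow> xs \<in> tuples (num_leaves t) (carrier G) \<Longrightarrow>
      tree_op \<omega> t xs =
        a [^] num_internal t \<otimes> twisted_prod G (conj_by (inv a)) (right_weights t) xs"
    and xs: "xs \<in> tuples (num_leaves (Node ts)) (carrier G)"
  shows "set (forest_op \<omega> ts xs) \<subseteq> carrier G \<and>
    list_prod G (forest_op \<omega> ts xs) =
      a [^] sum_list (map num_internal ts) \<otimes>
        twisted_prod G (conj_by (inv a)) (right_weights (Node ts)) xs"
  using trees xs
proof (induction ts arbitrary: xs)
  case Nil
  then show ?case by (simp add: twisted_prod_def)
next
  case (Cons t ts)
  let ?\<phi> = "conj_by (inv a)" and ?N = "num_internal t" and ?M = "sum_list (map num_internal ts)"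
    and ?ys = "take (num_leaves t) xs" and ?zs = "drop (num_leaves t) xs"
  have \<phi>: "?\<phi> \<in> iso G G" using a by (simp add: conj_by_iso)
  have xs: "set xs \<subseteq> carrier G" and ys: "?ys \<in> tuples (num_leaves t) (carrier G)"
    and zs: "?zs \<in> tuples (num_leaves (Node ts)) (carrier G)"
    using Cons.prems(2) by (auto simp: tuples_def dest: in_set_takeD in_set_dropD)
  define A where "A = twisted_prod G ?\<phi> (right_weights t) ?ys"
  define B where "B = twisted_prod G ?\<phi> (right_weights (Node ts)) ?zs"
  have AB: "A \<in> carrier G" "B \<in> carrier G"
    unfolding A_def B_def using ys zs \<phi> by (auto intro!: twisted_prod_closed simp: tuples_def)
  have t: "tree_op \<omega> t ?ys = a [^] ?N \<otimes> A"
    unfolding A_def using Cons.prems(1) ys by simp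
  have ts: "set (forest_op \<omega> ts ?zs) \<subseteq> carrier G"
    "list_prod G (forest_op \<omega> ts ?zs) = a [^] ?M \<otimes> B"
    using Cons.IH[OF Cons.prems(1) zs] unfolding B_def by auto
  have "twisted_prod G ?\<phi> (right_weights (Node (t # ts))) xs = (?\<phi> ^^ ?M) A \<otimes> B"
    unfolding right_weights_Node_Cons twisted_prod_append[OF \<phi> xs]
    using twisted_prod_shift[OF \<phi>, of ?ys ?M "right_weights t"] ys
    by (simp add: A_def B_def length_leaf_paths tuples_def del: leaf_paths.simps map_map)
  moreover have "a [^] ?N \<otimes> A \<otimes> (a [^] ?M \<otimes> B) = a [^] (?N + ?M) \<otimes> ((?\<phi> ^^ ?M) A \<otimes> B)"
  proof -
    have "a [^] ?N \<otimes> A \<otimes> (a [^] ?M \<otimes> B) = a [^] ?N \<otimes> (A \<otimes> a [^] ?M) \<otimes> B"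
      using a AB by (simp add: m_assoc)
    also have "\<dots> = a [^] ?N \<otimes> (a [^] ?M \<otimes> (?\<phi> ^^ ?M) A) \<otimes> B"
      using a AB by (simp add: funpow_conj_by_inv_commute)
    also have "\<dots> = a [^] (?N + ?M) \<otimes> ((?\<phi> ^^ ?M) A \<otimes> B)"
      using a AB iso_closed[OF funpow_iso[OF \<phi>]] by (simp add: m_assoc nat_pow_mult[symmetric])
    finally show ?thesis .
  qed
  ultimately show ?case
    using t ts a AB by (simp del: leaf_paths.simps)
qed

lemma tree_op_left_factor:
  assumes a: "a \<in> carrier G"
    and \<omega>: "\<And>xs. xs \<in> tuples r (carrier G) \<Longrightarrow> \<omega> xs = a \<otimes> list_prod G xs"
    and "full_tree r T" "xs \<in> tuples (num_leaves T) (carrier G)"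
  shows "tree_op \<omega> T xs =
    a [^] num_internal T \<otimes> twisted_prod G (conj_by (inv a)) (right_weights T) xs"
  using assms(3,4)
proof (induction T arbitrary: xs)
  case Leaf
  then show ?case by (cases xs) (auto simp: tuples_def twisted_prod_def)
next
  case (Node ts)
  have forest: "set (forest_op \<omega> ts xs) \<subseteq> carrier G"
    "list_prod G (forest_op \<omega> ts xs) = a [^] sum_list (map num_internal ts) \<otimes>
        twisted_prod G (conj_by (inv a)) (right_weights (Node ts)) xs"
    using forest_op_left_factor[OF a, of ts \<omega> xs] Node by auto
  then have "forest_op \<omega> ts xs \<in> tuples r (carrier G)"
    using Node.prems by (simp add: tuples_def length_forest_op)
  moreover have "twisted_prod G (conj_by (inv a)) (right_weights (Node ts)) xs \<in> carrier G"
    using Node.prems a by (intro twisted_prod_closed conj_by_iso) (auto simp: tuples_def)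
  moreover have "a [^] num_internal (Node ts) = a \<otimes> a [^] sum_list (map num_internal ts)"
    using nat_pow_Suc2[OF a] by (simp only: num_internal.simps)
  ultimately show ?case
    using forest(2) a by (simp add: \<omega> m_assoc del: leaf_paths.simps num_internal.simps)
qed

text \<open>
  Mirror image of the previous computation: the letters \<open>b\<close> of the first child pass the values of
  all later children, whose exponents grow accordingly.
\<close>

lemma forest_op_right_factor:
  assumes b: "b \<in> carrier G"
    and trees: "\<And>t xs. t \<in> set ts \<Longrightarrow> xs \<in> tuples (num_leaves t) (carrier G) \<Longrightarrow>
      tree_op \<omega> t xs = twisted_prod G (conj_by b) (left_weights t) xs \<otimes> b [^] num_internal t"
    and xs: "xs \<in> tuples (num_leaves (Node ts)) (carrier G)"
  shows "set (forest_op \<omega> ts xs) \<subseteq> carrier G \<and>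
    list_prod G (forest_op \<omega> ts xs) =
      twisted_prod G (conj_by b) (left_weights (Node ts)) xs \<otimes>
        b [^] sum_list (map num_internal ts)"
  using trees xs
proof (induction ts arbitrary: xs)
  case Nil
  then show ?case by (simp add: twisted_prod_def)
next
  case (Cons t ts)
  let ?\<phi> = "conj_by b" and ?N = "num_internal t" and ?M = "sum_list (map num_internal ts)"
    and ?ys = "take (num_leaves t) xs" and ?zs = "drop (num_leaves t) xs"
  have \<phi>: "?\<phi> \<in> iso G G" using b by (simp add: conj_by_iso)
  have xs: "set xs \<subseteq> carrier G" and ys: "?ys \<in> tuples (num_leaves t) (carrier G)"
    and zs: "?zs \<in> tuples (num_leaves (Node ts)) (carrier G)"
    using Cons.prems(2) by (auto simp: tuples_def dest: in_set_takeD in_set_dropD)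
  define A where "A = twisted_prod G ?\<phi> (left_weights t) ?ys"
  define B where "B = twisted_prod G ?\<phi> (left_weights (Node ts)) ?zs"
  have AB: "A \<in> carrier G" "B \<in> carrier G"
    unfolding A_def B_def using ys zs \<phi> by (auto intro!: twisted_prod_closed simp: tuples_def)
  have t: "tree_op \<omega> t ?ys = A \<otimes> b [^] ?N"
    unfolding A_def using Cons.prems(1) ys by simp
  have ts: "set (forest_op \<omega> ts ?zs) \<subseteq> carrier G"
    "list_prod G (forest_op \<omega> ts ?zs) = B \<otimes> b [^] ?M"
    using Cons.IH[OF Cons.prems(1) zs] unfolding B_def by auto
  have "twisted_prod G ?\<phi> (left_weights (Node (t # ts))) xs = A \<otimes> (?\<phi> ^^ ?N) B"
    unfolding left_weights_Node_Cons twisted_prod_append[OF \<phi> xs]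
    using twisted_prod_shift[OF \<phi>, of ?zs ?N "left_weights (Node ts)"] zs
    by (simp add: A_def B_def length_leaf_paths tuples_def del: leaf_paths.simps map_map)
  moreover have "A \<otimes> b [^] ?N \<otimes> (B \<otimes> b [^] ?M) = A \<otimes> (?\<phi> ^^ ?N) B \<otimes> b [^] (?N + ?M)"
  proof -
    have "A \<otimes> b [^] ?N \<otimes> (B \<otimes> b [^] ?M) = A \<otimes> (b [^] ?N \<otimes> B) \<otimes> b [^] ?M"
      using b AB by (simp add: m_assoc)
    also have "\<dots> = A \<otimes> ((?\<phi> ^^ ?N) B \<otimes> b [^] ?N) \<otimes> b [^] ?M"
      using b AB by (simp add: funpow_conj_by_commute)
    also have "\<dots> = A \<otimes> (?\<phi> ^^ ?N) B \<otimes> b [^] (?N + ?M)"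
      using b AB iso_closed[OF funpow_iso[OF \<phi>]] by (simp add: m_assoc nat_pow_mult[symmetric])
    finally show ?thesis .
  qed
  ultimately show ?case
    using t ts b AB by (simp del: leaf_paths.simps)
qed

lemma tree_op_right_factor:
  assumes b: "b \<in> carrier G"
    and \<omega>: "\<And>xs. xs \<in> tuples r (carrier G) \<Longrightarrow> \<omega> xs = list_prod G xs \<otimes> b"
    and "full_tree r T" "xs \<in> tuples (num_leaves T) (carrier G)"
  shows "tree_op \<omega> T xs =
    twisted_prod G (conj_by b) (left_weights T) xs \<otimes> b [^] num_internal T"
  using assms(3,4)
proof (induction T arbitrary: xs)
  case Leaf
  then show ?case by (cases xs) (auto simp: tuples_def twisted_prod_def)
next
  case (Node ts)
  have forest: "set (forest_op \<omega> ts xs) \<subseteq> carrier G"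
    "list_prod G (forest_op \<omega> ts xs) =
       twisted_prod G (conj_by b) (left_weights (Node ts)) xs \<otimes>
         b [^] sum_list (map num_internal ts)"
    using forest_op_right_factor[OF b, of ts \<omega> xs] Node by auto
  then have "forest_op \<omega> ts xs \<in> tuples r (carrier G)"
    using Node.prems by (simp add: tuples_def length_forest_op)
  moreover have "twisted_prod G (conj_by b) (left_weights (Node ts)) xs \<in> carrier G"
    using Node.prems b by (intro twisted_prod_closed conj_by_iso) (auto simp: tuples_def)
  ultimately show ?case
    using forest(2) b by (simp add: \<omega> m_assoc del: leaf_paths.simps)
qed

lemma center_mult_closed:
  "y \<in> group_center G \<Longrightarrow> z \<in> group_center G \<Longrightarrow> y \<otimes> z \<in> group_center G"
  using normal_imp_subgroup[OF group_center_normal] by (rule subgroup.m_closed)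

text \<open>
  The center is characteristic, so the constants produced at lower vertices stay central under
  the applications of \<open>\<phi>\<close> higher up.
\<close>

lemma iso_center_closed:
  assumes \<phi>: "\<phi> \<in> iso G G" and z: "z \<in> group_center G"
  shows "\<phi> z \<in> group_center G"
proof -
  have "\<phi> z \<otimes> g = g \<otimes> \<phi> z" if "g \<in> carrier G" for g
  proof -
    have "g \<in> \<phi> ` carrier G"
      using \<phi> that by (simp add: iso_def bij_betw_def)
    then obtain h where "h \<in> carrier G" "g = \<phi> h"
      by blast
    then show ?thesis
      using z group_centerD by (simp add: iso_mult[OF \<phi>, symmetric])
  qed
  then show ?thesis
    using z by (simp add: group_center_def iso_closed[OF \<phi>])
qed

text \<open>
  The depths of the leaves under a root already count the step to the children, so the exponents
  match once \<open>\<phi>\<close> has been applied to the product of the children's values; this is why the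
  conclusion is about the image under \<open>\<phi>\<close>.  The constant is quantified outside the inputs,
  because the criterion compares the values at different inputs.
\<close>

lemma forest_op_central_factor:
  assumes \<phi>: "\<phi> \<in> iso G G"
    and trees: "\<And>t. t \<in> set ts \<Longrightarrow> \<exists>C\<in>group_center G.
      \<forall>xs\<in>tuples (num_leaves t) (carrier G).
        tree_op \<omega> t xs = C \<otimes> twisted_prod G \<phi> (depths t) xs"
  shows "\<exists>C\<in>group_center G. \<forall>xs\<in>tuples (num_leaves (Node ts)) (carrier G).
    set (forest_op \<omega> ts xs) \<subseteq> carrier G \<and>
    \<phi> (list_prod G (forest_op \<omega> ts xs)) = C \<otimes> twisted_prod G \<phi> (depths (Node ts)) xs"
  using trees
proof (induction ts)
  case Nil
  have "\<one> \<in> group_center G" by (simp add: group_center_def)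
  then show ?case by (force simp: twisted_prod_def iso_one[OF \<phi>])
next
  case (Cons t ts)
  obtain C where C: "C \<in> group_center G"
    and t: "\<And>xs. xs \<in> tuples (num_leaves t) (carrier G) \<Longrightarrow>
      tree_op \<omega> t xs = C \<otimes> twisted_prod G \<phi> (depths t) xs"
    using Cons.prems[of t] by auto
  obtain D where D: "D \<in> group_center G"
    and ts: "\<And>xs. xs \<in> tuples (num_leaves (Node ts)) (carrier G) \<Longrightarrow>
      set (forest_op \<omega> ts xs) \<subseteq> carrier G"
      "\<And>xs. xs \<in> tuples (num_leaves (Node ts)) (carrier G) \<Longrightarrow>
      \<phi> (list_prod G (forest_op \<omega> ts xs)) = D \<otimes> twisted_prod G \<phi> (depths (Node ts)) xs"
    using Cons.IH Cons.prems by auto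
  have \<phi>C: "\<phi> C \<in> group_center G" by (rule iso_center_closed[OF \<phi> C])
  have "set (forest_op \<omega> (t # ts) xs) \<subseteq> carrier G \<and>
      \<phi> (list_prod G (forest_op \<omega> (t # ts) xs)) =
        (\<phi> C \<otimes> D) \<otimes> twisted_prod G \<phi> (depths (Node (t # ts))) xs"
    if xs: "xs \<in> tuples (num_leaves (Node (t # ts))) (carrier G)" for xs
  proof -
    let ?ys = "take (num_leaves t) xs" and ?zs = "drop (num_leaves t) xs"
    have xs: "set xs \<subseteq> carrier G" and ys: "?ys \<in> tuples (num_leaves t) (carrier G)"
      and zs: "?zs \<in> tuples (num_leaves (Node ts)) (carrier G)"
      using xs by (auto simp: tuples_def dest: in_set_takeD in_set_dropD)
    define A where "A = twisted_prod G \<phi> (depths t) ?ys"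
    define B where "B = twisted_prod G \<phi> (depths (Node ts)) ?zs"
    have AB: "A \<in> carrier G" "B \<in> carrier G"
      unfolding A_def B_def using ys zs \<phi> by (auto intro!: twisted_prod_closed simp: tuples_def)
    have "twisted_prod G \<phi> (depths (Node (t # ts))) xs = \<phi> A \<otimes> B"
      unfolding depths_Node_Cons twisted_prod_append[OF \<phi> xs]
      using twisted_prod_shift[OF \<phi>, of ?ys 1 "depths t", unfolded plus_1_eq_Suc] ys
      by (simp add: A_def B_def length_leaf_paths tuples_def del: leaf_paths.simps map_map)
    moreover have "\<phi> (C \<otimes> A \<otimes> list_prod G (forest_op \<omega> ts ?zs)) = \<phi> C \<otimes> \<phi> A \<otimes> (D \<otimes> B)"
      using C AB ts[OF zs] \<phi>
      by (simp add: iso_mult list_prod_closed group_centerD(1) B_def del: leaf_paths.simps)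
    moreover have "\<phi> C \<otimes> \<phi> A \<otimes> (D \<otimes> B) = (\<phi> C \<otimes> D) \<otimes> (\<phi> A \<otimes> B)"
    proof -
      have cl: "\<phi> C \<in> carrier G" "\<phi> A \<in> carrier G" "D \<in> carrier G"
        using \<phi>C D AB iso_closed[OF \<phi>] group_centerD(1) by auto
      then have "\<phi> C \<otimes> \<phi> A \<otimes> (D \<otimes> B) = \<phi> C \<otimes> (\<phi> A \<otimes> D) \<otimes> B"
        using AB by (simp add: m_assoc)
      also have "\<dots> = \<phi> C \<otimes> (D \<otimes> \<phi> A) \<otimes> B"
        using group_centerD(2)[OF D] cl by simp
      finally show ?thesis
        using AB cl by (simp add: m_assoc)
    qed
    ultimately show ?thesis
      using t[OF ys] ts(1)[OF zs] C AB
      by (simp add: A_def[symmetric] group_centerD(1) del: leaf_paths.simps)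
  qed
  then show ?case
    using center_mult_closed[OF \<phi>C D] by blast
qed

lemma tree_op_central_factor:
  assumes \<phi>: "\<phi> \<in> iso G G" and d: "d \<in> group_center G"
    and \<omega>: "\<And>xs. xs \<in> tuples r (carrier G) \<Longrightarrow> \<omega> xs = d \<otimes> \<phi> (list_prod G xs)"
    and "full_tree r T"
  obtains C where "C \<in> group_center G"
    "\<And>xs. xs \<in> tuples (num_leaves T) (carrier G) \<Longrightarrow>
      tree_op \<omega> T xs = C \<otimes> twisted_prod G \<phi> (depths T) xs"
proof -
  have "\<exists>C\<in>group_center G. \<forall>xs\<in>tuples (num_leaves T) (carrier G).
      tree_op \<omega> T xs = C \<otimes> twisted_prod G \<phi> (depths T) xs"
    using assms(4)
  proof (induction T)
    case Leaf
    have "\<one> \<in> group_center G" by (simp add: group_center_def)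
    moreover have "tree_op \<omega> Leaf xs = \<one> \<otimes> twisted_prod G \<phi> (depths Leaf) xs"
      if "xs \<in> tuples (num_leaves Leaf) (carrier G)" for xs
      using that by (cases xs) (auto simp: tuples_def twisted_prod_def)
    ultimately show ?case by blast
  next
    case (Node ts)
    obtain C where C: "C \<in> group_center G"
      and forest: "\<And>xs. xs \<in> tuples (num_leaves (Node ts)) (carrier G) \<Longrightarrow>
        set (forest_op \<omega> ts xs) \<subseteq> carrier G"
        "\<And>xs. xs \<in> tuples (num_leaves (Node ts)) (carrier G) \<Longrightarrow>
        \<phi> (list_prod G (forest_op \<omega> ts xs)) = C \<otimes> twisted_prod G \<phi> (depths (Node ts)) xs"
      using forest_op_central_factor[OF \<phi>, of ts \<omega>] Node by auto
    have "tree_op \<omega> (Node ts) xs = (d \<otimes> C) \<otimes> twisted_prod G \<phi> (depths (Node ts)) xs"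
      if xs: "xs \<in> tuples (num_leaves (Node ts)) (carrier G)" for xs
    proof -
      have "forest_op \<omega> ts xs \<in> tuples r (carrier G)"
        using forest(1)[OF xs] Node.prems by (simp add: tuples_def length_forest_op)
      moreover have "twisted_prod G \<phi> (depths (Node ts)) xs \<in> carrier G"
        using xs by (intro twisted_prod_closed[OF \<phi>]) (auto simp: tuples_def)
      ultimately show ?thesis
        using forest(2)[OF xs] C d
        by (simp add: \<omega> m_assoc group_centerD(1) del: leaf_paths.simps)
    qed
    then show ?case
      using center_mult_closed[OF d C] by blast
  qed
  then show ?thesis
    using that by blast
qed

section \<open>The four families of operations\<close>

lemma auto_iso: "\<psi> \<in> carrier (AutoGroup G) \<Longrightarrow> \<psi> \<in> iso G G"
  by (auto simp: AutoGroup_def auto_def iso_def Bij_def)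

text \<open>
  The operation of the automorphism group restricts composites to the carrier, so its powers
  agree with iterates only there.
\<close>

lemma AutoGroup_pow_apply:
  assumes \<psi>: "\<psi> \<in> carrier (AutoGroup G)" and x: "x \<in> carrier G"
  shows "(\<psi> [^]\<^bsub>AutoGroup G\<^esub> (m::nat)) x = (\<psi> ^^ m) x"
  using x
proof (induction m arbitrary: x)
  interpret A: group "AutoGroup G" by (rule AutoGroup)
  case 0
  have "\<one>\<^bsub>AutoGroup G\<^esub> x = x"
    using 0 by (simp add: AutoGroup_def BijGroup_def)
  then show ?case
    by (simp only: A.nat_pow_0 funpow_0)
next
  interpret A: group "AutoGroup G" by (rule AutoGroup)
  case (Suc m)
  have "f \<in> Bij (carrier G)" if "f \<in> carrier (AutoGroup G)" for f
    using that by (simp add: AutoGroup_def auto_def)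
  then have "(f \<otimes>\<^bsub>AutoGroup G\<^esub> \<psi>) x = f (\<psi> x)" if "f \<in> carrier (AutoGroup G)" for f
    using that \<psi> Suc.prems by (simp add: AutoGroup_def BijGroup_def compose_def)
  then have "(\<psi> [^]\<^bsub>AutoGroup G\<^esub> Suc m) x = (\<psi> [^]\<^bsub>AutoGroup G\<^esub> m) (\<psi> x)"
    using A.nat_pow_closed[OF \<psi>] by (simp only: A.nat_pow_Suc)
  also have "\<dots> = (\<psi> ^^ m) (\<psi> x)"
    by (rule Suc.IH[OF iso_closed[OF auto_iso[OF \<psi>] Suc.prems]])
  also have "\<dots> = (\<psi> ^^ Suc m) x"
    by (simp only: funpow_Suc_right o_apply)
  finally show ?case .
qed

lemma funpow_auto_eq_id_iff:
  assumes \<psi>: "\<psi> \<in> carrier (AutoGroup G)"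
  shows "(\<forall>x\<in>carrier G. (\<psi> ^^ m) x = x) \<longleftrightarrow> group.ord (AutoGroup G) \<psi> dvd m"
proof -
  interpret A: group "AutoGroup G" by (rule AutoGroup)
  define p where "p = \<psi> [^]\<^bsub>AutoGroup G\<^esub> m"
  have one: "\<one>\<^bsub>AutoGroup G\<^esub> = (\<lambda>x\<in>carrier G. x)"
    by (simp add: AutoGroup_def BijGroup_def)
  have "p \<in> carrier (AutoGroup G)"
    unfolding p_def by (rule A.nat_pow_closed[OF \<psi>])
  then have ext: "p \<in> extensional (carrier G)"
    by (simp add: AutoGroup_def auto_def Bij_def)
  have p: "(\<psi> ^^ m) x = p x" if "x \<in> carrier G" for x
    unfolding p_def using AutoGroup_pow_apply[OF \<psi> that] by simp
  have "(\<forall>x\<in>carrier G. (\<psi> ^^ m) x = x) \<longleftrightarrow> (\<forall>x\<in>carrier G. p x = x)"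
    using p by simp
  also have "\<dots> \<longleftrightarrow> p = (\<lambda>x\<in>carrier G. x)"
    using extensionalityI[OF ext restrict_extensional] by (metis restrict_apply')
  also have "\<dots> \<longleftrightarrow> group.ord (AutoGroup G) \<psi> dvd m"
    using A.pow_eq_id[OF \<psi>, of m] by (simp only: p_def one)
  finally show ?thesis .
qed

text \<open>
  On the path to the rightmost leaf nothing lies to the right, so the weight \<open>0\<close> occurs and
  congruence of the weights with each other becomes divisibility of each of them.
\<close>

lemma factors_left_factor_iff:
  assumes a: "a \<in> carrier G" and r: "0 < r" and T: "full_tree r T"
    and \<omega>: "\<And>xs. xs \<in> tuples r (carrier G) \<Longrightarrow> \<omega> xs = a \<otimes> list_prod G xs"
  shows "factors_through_product G \<omega> T \<longleftrightarrow>
    (\<forall>w\<in>set (right_weights T). ord_mod_center G a dvd w)"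
proof -
  have "factors_through_product G \<omega> T \<longleftrightarrow>
      (\<forall>u\<in>set (right_weights T). \<forall>w\<in>set (right_weights T). [u = w] (mod ord_mod_center G a))"
  proof (rule twisted_factorization_criterion[where C = "a [^] num_internal T" and D = \<one>])
    show "conj_by (inv a) \<in> iso G G"
      using a by (simp add: conj_by_iso)
    show "(\<forall>x\<in>carrier G. (conj_by (inv a) ^^ m) x = x) \<longleftrightarrow> ord_mod_center G a dvd m" for m
      using funpow_conj_by_eq_id_iff[of "inv a" m] a by (simp add: ord_mod_center_inv)
    show "tree_op \<omega> T xs =
        a [^] num_internal T \<otimes> twisted_prod G (conj_by (inv a)) (right_weights T) xs \<otimes> \<one>"
      if "xs \<in> tuples (num_leaves T) (carrier G)" for xs
    proof -
      have "twisted_prod G (conj_by (inv a)) (right_weights T) xs \<in> carrier G"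
        using that a by (intro twisted_prod_closed conj_by_iso) (auto simp: tuples_def)
      then show ?thesis
        using tree_op_left_factor[where r = r, OF a \<omega> T that] a by simp
    qed
  qed (use a in \<open>simp_all add: length_leaf_paths\<close>)
  also have "\<dots> \<longleftrightarrow> (\<forall>w\<in>set (right_weights T). ord_mod_center G a dvd w)"
    by (rule pairwise_cong_iff_dvd[OF zero_right_weight[OF T r]])
  finally show ?thesis .
qed

lemma factors_right_factor_iff:
  assumes b: "b \<in> carrier G" and r: "0 < r" and T: "full_tree r T"
    and \<omega>: "\<And>xs. xs \<in> tuples r (carrier G) \<Longrightarrow> \<omega> xs = list_prod G xs \<otimes> b"
  shows "factors_through_product G \<omega> T \<longleftrightarrow>
    (\<forall>w\<in>set (left_weights T). ord_mod_center G b dvd w)"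
proof -
  have "factors_through_product G \<omega> T \<longleftrightarrow>
      (\<forall>u\<in>set (left_weights T). \<forall>w\<in>set (left_weights T). [u = w] (mod ord_mod_center G b))"
  proof (rule twisted_factorization_criterion[where C = \<one> and D = "b [^] num_internal T"])
    show "tree_op \<omega> T xs =
        \<one> \<otimes> twisted_prod G (conj_by b) (left_weights T) xs \<otimes> b [^] num_internal T"
      if "xs \<in> tuples (num_leaves T) (carrier G)" for xs
    proof -
      have "twisted_prod G (conj_by b) (left_weights T) xs \<in> carrier G"
        using that b by (intro twisted_prod_closed conj_by_iso) (auto simp: tuples_def)
      then show ?thesis
        using tree_op_right_factor[where r = r, OF b \<omega> T that] by simp
    qed
  qed (use b in \<open>simp_all add: length_leaf_paths conj_by_iso funpow_conj_by_eq_id_iff\<close>)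
  also have "\<dots> \<longleftrightarrow> (\<forall>w\<in>set (left_weights T). ord_mod_center G b dvd w)"
    by (rule pairwise_cong_iff_dvd[OF zero_left_weight[OF T r]])
  finally show ?thesis .
qed

lemma factors_central_factor_iff:
  assumes \<phi>: "\<phi> \<in> iso G G" and d: "d \<in> group_center G" and T: "full_tree r T"
    and k: "\<And>m. (\<forall>x\<in>carrier G. (\<phi> ^^ m) x = x) \<longleftrightarrow> k dvd m"
    and \<omega>: "\<And>xs. xs \<in> tuples r (carrier G) \<Longrightarrow> \<omega> xs = d \<otimes> \<phi> (list_prod G xs)"
  shows "factors_through_product G \<omega> T \<longleftrightarrow>
    (\<forall>u\<in>set (depths T). \<forall>w\<in>set (depths T). [u = w] (mod k))"
proof -
  obtain C where C: "C \<in> group_center G"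
    and op: "\<And>xs. xs \<in> tuples (num_leaves T) (carrier G) \<Longrightarrow>
      tree_op \<omega> T xs = C \<otimes> twisted_prod G \<phi> (depths T) xs"
    using tree_op_central_factor[where r = r, OF \<phi> d \<omega> T] by blast
  show ?thesis
  proof (rule twisted_factorization_criterion[OF \<phi> k, where C = C and D = \<one>])
    show "tree_op \<omega> T xs = C \<otimes> twisted_prod G \<phi> (depths T) xs \<otimes> \<one>"
      if "xs \<in> tuples (num_leaves T) (carrier G)" for xs
    proof -
      have "twisted_prod G \<phi> (depths T) xs \<in> carrier G"
        using that by (intro twisted_prod_closed[OF \<phi>]) (auto simp: tuples_def)
      then show ?thesis
        using op[OF that] C by (simp add: group_centerD(1))
    qed
  qed (use C in \<open>simp_all add: length_leaf_paths group_centerD(1)\<close>)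
qed

end


theorem corollary3p5:
  fixes G (structure) and r :: nat and \<omega> :: "'a list \<Rightarrow> 'a"
  assumes "group G" and "r \<ge> 2"
  shows
    "(\<forall>c \<in> group_center G.
        (\<forall>xs \<in> tuples r (carrier G). \<omega> xs = c \<otimes> list_prod G xs) \<longrightarrow>
        (\<forall>T. full_tree r T \<longrightarrow> factors_through_product G \<omega> T))
   \<and> (\<forall>a \<in> carrier G - group_center G. \<forall>T.
        (\<forall>xs \<in> tuples r (carrier G). \<omega> xs = a \<otimes> list_prod G xs) \<longrightarrow> full_tree r T \<longrightarrow>
        (let k = ord_mod_center G a in
          (k \<noteq> 0 \<longrightarrow> (factors_through_product G \<omega> T \<longleftrightarrow>
                       (\<forall>i \<in> {1..num_leaves T}. k dvd rho T i))) \<and>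
          (k = 0 \<longrightarrow> (factors_through_product G \<omega> T \<longleftrightarrow>
                       (\<forall>i \<in> {1..num_leaves T}. rho T i = 0)))))
   \<and> (\<forall>b \<in> carrier G - group_center G. \<forall>T.
        (\<forall>xs \<in> tuples r (carrier G). \<omega> xs = list_prod G xs \<otimes> b) \<longrightarrow> full_tree r T \<longrightarrow>
        (let k = ord_mod_center G b in
          (k \<noteq> 0 \<longrightarrow> (factors_through_product G \<omega> T \<longleftrightarrow>
                       (\<forall>i \<in> {1..num_leaves T}. k dvd lam T i))) \<and>
          (k = 0 \<longrightarrow> (factors_through_product G \<omega> T \<longleftrightarrow>
                       (\<forall>i \<in> {1..num_leaves T}. lam T i = 0)))))
   \<and> (\<forall>d \<in> group_center G. \<forall>\<psi> \<in> carrier (AutoGroup G). \<forall>T.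
        \<psi> \<noteq> \<one>\<^bsub>AutoGroup G\<^esub> \<longrightarrow>
        (\<forall>xs \<in> tuples r (carrier G). \<omega> xs = d \<otimes> \<psi> (list_prod G xs)) \<longrightarrow> full_tree r T \<longrightarrow>
        (let h = group.ord (AutoGroup G) \<psi> in
          (h \<noteq> 0 \<longrightarrow> (factors_through_product G \<omega> T \<longleftrightarrow>
                       (\<forall>i \<in> {1..num_leaves T}. \<forall>j \<in> {1..num_leaves T}.
                          [leaf_depth T i = leaf_depth T j] (mod h)))) \<and>
          (h = 0 \<longrightarrow> (factors_through_product G \<omega> T \<longleftrightarrow>
                       (\<forall>i \<in> {1..num_leaves T}. \<forall>j \<in> {1..num_leaves T}.
                          leaf_depth T i = leaf_depth T j)))))"
proof (intro conjI ballI allI impI)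
  interpret group G by fact
  show "factors_through_product G \<omega> T"
    if c: "c \<in> group_center G" and \<omega>: "\<forall>xs\<in>tuples r (carrier G). \<omega> xs = c \<otimes> list_prod G xs"
      and T: "full_tree r T" for c T
  proof -
    have "((\<lambda>x. x) ^^ m) x = x" for m and x :: 'a
      by (induction m) simp_all
    \<comment> \<open>The identity is the automorphism of order one, and modulo one all depths agree.\<close>
    then show ?thesis
      using factors_central_factor_iff[of "\<lambda>x. x" c r T 1 \<omega>] c \<omega> T
      by (simp add: iso_set_refl)
  qed
next
  interpret group G by fact
  fix a T
  assume a: "a \<in> carrier G - group_center G"
    and \<omega>: "\<forall>xs\<in>tuples r (carrier G). \<omega> xs = a \<otimes> list_prod G xs" and T: "full_tree r T"
  have "factors_through_product G \<omega> T \<longleftrightarrow>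
      (\<forall>i\<in>{1..num_leaves T}. ord_mod_center G a dvd rho T i)"
    using factors_left_factor_iff[of a r T \<omega>] a \<omega> T \<open>r \<ge> 2\<close>
    unfolding ball_leaves rho_def by simp
  then show "let k = ord_mod_center G a in
      (k \<noteq> 0 \<longrightarrow> (factors_through_product G \<omega> T \<longleftrightarrow> (\<forall>i\<in>{1..num_leaves T}. k dvd rho T i))) \<and>
      (k = 0 \<longrightarrow> (factors_through_product G \<omega> T \<longleftrightarrow> (\<forall>i\<in>{1..num_leaves T}. rho T i = 0)))"
    by (simp add: Let_def)
next
  interpret group G by fact
  fix b T
  assume b: "b \<in> carrier G - group_center G"
    and \<omega>: "\<forall>xs\<in>tuples r (carrier G). \<omega> xs = list_prod G xs \<otimes> b" and T: "full_tree r T"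
  have "factors_through_product G \<omega> T \<longleftrightarrow>
      (\<forall>i\<in>{1..num_leaves T}. ord_mod_center G b dvd lam T i)"
    using factors_right_factor_iff[of b r T \<omega>] b \<omega> T \<open>r \<ge> 2\<close>
    unfolding ball_leaves lam_def by simp
  then show "let k = ord_mod_center G b in
      (k \<noteq> 0 \<longrightarrow> (factors_through_product G \<omega> T \<longleftrightarrow> (\<forall>i\<in>{1..num_leaves T}. k dvd lam T i))) \<and>
      (k = 0 \<longrightarrow> (factors_through_product G \<omega> T \<longleftrightarrow> (\<forall>i\<in>{1..num_leaves T}. lam T i = 0)))"
    by (simp add: Let_def)
next
  interpret group G by fact
  fix d \<psi> T
  assume d: "d \<in> group_center G" and \<psi>: "\<psi> \<in> carrier (AutoGroup G)"
    and \<omega>: "\<forall>xs\<in>tuples r (carrier G). \<omega> xs = d \<otimes> \<psi> (list_prod G xs)" and T: "full_tree r T"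
  have "factors_through_product G \<omega> T \<longleftrightarrow>
      (\<forall>i\<in>{1..num_leaves T}. \<forall>j\<in>{1..num_leaves T}.
        [leaf_depth T i = leaf_depth T j] (mod group.ord (AutoGroup G) \<psi>))"
    using factors_central_factor_iff[OF auto_iso[OF \<psi>] d T funpow_auto_eq_id_iff[OF \<psi>], of \<omega>] \<omega>
    unfolding ball_leaves leaf_depth_def by simp
  then show "let h = group.ord (AutoGroup G) \<psi> in
      (h \<noteq> 0 \<longrightarrow> (factors_through_product G \<omega> T \<longleftrightarrow>
        (\<forall>i\<in>{1..num_leaves T}. \<forall>j\<in>{1..num_leaves T}.
          [leaf_depth T i = leaf_depth T j] (mod h)))) \<and>
      (h = 0 \<longrightarrow> (factors_through_product G \<omega> T \<longleftrightarrow>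
        (\<forall>i\<in>{1..num_leaves T}. \<forall>j\<in>{1..num_leaves T}. leaf_depth T i = leaf_depth T j)))"
    by (simp add: Let_def)
qed

end
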